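(* Let $p$ be a prime and $n,k$ positive integers such that $S(n,k)$ is a minimum zero case. Let $b$ be an integer with $0\le b<\min\{p^{\nu_p(k)},p^{\nu_p(n)}\}$, and put $n'=n+b$, $k'=k+b$. Then $S(n',k')$ is a minimum zero case, and (i) $\nu_p(S(n',k'))=\nu_p(S(n,k))$; (ii) $\epsilon_p(S(n',k'))\equiv \epsilon_p(S(n,k)) \pmod p$.
   Context: $S(n,k)$ is the Stirling number of the second kind, $\nu_p$ the $p$-adic valuation, $\sigma_p(m)$ the base-$p$ digit sum, and $\epsilon_p(x)=p^{-\nu_p(x)}x$ the unit part of a nonzero rational $x$. $S(n,k)$ is called a minimum zero case if $\nu_p(S(n,k)) = (\sigma_p(k)-\sigma_p(n))/(p-1)$. *)

theory Defs
  imports Complex_Main "HOL-Number_Theory.Cong" "HOL-Combinatorics.Stirling"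
begin

text \<open>Base-\<open>p\<close> digit sum. The summand is the digit of \<open>m\<close> at place \<open>i\<close>; as \<open>m < p ^ m\<close> for \<open>p \<ge> 2\<close>,
  all places \<open>i \<ge> m\<close> carry the digit zero.\<close>

definition digit_sum :: "nat \<Rightarrow> nat \<Rightarrow> nat" where
  "digit_sum p m = (\<Sum>i<m. (m div p ^ i) mod p)"

text \<open>Only meant for \<open>x \<noteq> 0\<close>; the value at \<open>0\<close> would be infinite and is \<open>0\<close> here.\<close>

definition padic_val :: "nat \<Rightarrow> rat \<Rightarrow> int" where
  "padic_val p x = int (multiplicity (int p) (fst (quotient_of x)))
                 - int (multiplicity (int p) (snd (quotient_of x)))"

definition padic_unit :: "nat \<Rightarrow> rat \<Rightarrow> rat" where
  "padic_unit p x = of_nat p powi (- padic_val p x) * x"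

text \<open>Congruence modulo \<open>p\<close> of rationals, i.e. modulo \<open>p\<close> times the ring of rationals with denominator
  prime to \<open>p\<close>. On integers this is the usual congruence.\<close>

definition rat_cong :: "nat \<Rightarrow> rat \<Rightarrow> rat \<Rightarrow> bool" where
  "rat_cong p x y \<longleftrightarrow> x = y \<or> padic_val p (x - y) \<ge> 1"

text \<open>A vanishing Stirling number has infinite valuation, so it is never a minimum zero case.\<close>

definition minimum_zero_case :: "nat \<Rightarrow> nat \<Rightarrow> nat \<Rightarrow> bool" where
  "minimum_zero_case p n k \<longleftrightarrow>
     Stirling n k \<noteq> 0 \<and>
     (of_int (padic_val p (of_nat (Stirling n k))) :: rat) =
       (of_nat (digit_sum p k) - of_nat (digit_sum p n)) / (of_nat p - 1)"

lemma padic_val_of_int: "padic_val p (of_int a) = int (multiplicity (int p) a)"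
  by (simp add: padic_val_def)

lemma padic_val_of_nat: "padic_val p (of_nat m) = int (multiplicity p m)"
  using padic_val_of_int[of p "int m"] by (simp add: multiplicity_def flip: of_nat_power)

lemma rat_cong_of_int:
  assumes "prime p"
  shows "rat_cong p (of_int a) (of_int b) \<longleftrightarrow> [a = b] (mod (int p))"
proof (cases "a = b")
  case False
  have p: "\<not> is_unit (int p)"
    using assms by auto
  have "rat_cong p (of_int a) (of_int b) \<longleftrightarrow> padic_val p (of_int (a - b)) \<ge> 1"
    using False by (simp add: rat_cong_def)
  also have "\<dots> \<longleftrightarrow> 1 \<le> multiplicity (int p) (a - b)"
    unfolding padic_val_of_int by linarith
  also have "\<dots> \<longleftrightarrow> int p ^ 1 dvd a - b"
    using False p by (subst power_dvd_iff_le_multiplicity) auto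
  finally show ?thesis by (simp add: cong_iff_dvd_diff)
qed (simp add: rat_cong_def)

end

theory Submission
  imports Defs "HOL-Computational_Algebra.Formal_Power_Series"
begin

unbundle fps_syntax

text \<open>Let \<open>f = (exp t - 1) / t\<close> and \<open>m = n - k\<close>. The coefficient of \<open>t ^ m\<close> in \<open>f ^ k\<close> is
  \<open>S(n, k) k! / n!\<close>; its valuation is at least \<open>- m / (p - 1)\<close>, and by Legendre's formula \<open>S(n, k)\<close> is a
  minimum zero case iff equality holds. Let \<open>p ^ r\<close> divide \<open>k\<close> and \<open>n\<close> with \<open>b < p ^ r\<close>. In
  \<open>f ^ (k + b) = f ^ k * f ^ b\<close> every product contributing to \<open>t ^ m\<close> except the one with the constant
  term of \<open>f ^ b\<close> exceeds the minimal valuation, so the \<open>m\<close>-th coefficients of \<open>f ^ (k + b)\<close> and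
  \<open>f ^ k\<close> have quotient congruent to 1. Since
  \<open>S(n + b, k + b) / S(n, k)\<close> is this quotient times \<open>((n + b) choose b) / ((k + b) choose b)\<close>, and
  both binomial coefficients are congruent to 1, the two Stirling numbers have quotient
  congruent to 1 as well.\<close>

section \<open>Digit sums\<close>

text \<open>Digits at places from \<open>m\<close> on vanish because \<open>m < 2 ^ m\<close>. A
  common length \<open>N\<close> makes digit sums of different numbers comparable.\<close>

lemma digit_sum_pad:
  assumes "p \<ge> 2" "m \<le> N"
  shows "digit_sum p m = (\<Sum>i<N. (m div p ^ i) mod p)"
proof -
  have "(m div p ^ i) mod p = 0" if "m \<le> i" for i
  proof -
    have "m < 2 ^ m" by simp
    also have "\<dots> \<le> p ^ m" using assms by (intro power_mono) auto
    also have "\<dots> \<le> p ^ i" using assms that by (intro power_increasing) auto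
    finally show ?thesis by simp
  qed
  then show ?thesis
    unfolding digit_sum_def using assms by (intro sum.mono_neutral_left) auto
qed

lemma digit_sum_mult_add:
  assumes "p \<ge> 2" "c < p"
  shows "digit_sum p (p * m + c) = c + digit_sum p m"
proof -
  define n where "n = p * m + c"
  have "m \<le> p * m" using assms by simp
  then have "m \<le> n" unfolding n_def by linarith
  have div: "n div p = m" and mod: "n mod p = c"
    using assms by (auto simp: n_def)
  have "digit_sum p n = (\<Sum>i<Suc n. (n div p ^ i) mod p)"
    using assms by (intro digit_sum_pad) auto
  also have "\<dots> = c + (\<Sum>i<n. (n div p ^ Suc i) mod p)"
    unfolding sum.lessThan_Suc_shift by (simp add: mod)
  also have "(\<Sum>i<n. (n div p ^ Suc i) mod p) = (\<Sum>i<n. (m div p ^ i) mod p)"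
    by (simp add: div_mult2_eq div)
  also have "\<dots> = digit_sum p m"
    using assms \<open>m \<le> n\<close> by (simp add: digit_sum_pad)
  finally show ?thesis by (simp add: n_def)
qed

lemma digit_sum_0 [simp]: "digit_sum p 0 = 0"
  by (simp add: digit_sum_def)

text \<open>There are no carries: \<open>a\<close> occupies only the \<open>r\<close> lowest places.
  The induction strips the last digit of \<open>a\<close>.\<close>

lemma digit_sum_add_power_mult:
  assumes "p \<ge> 2" "a < p ^ r"
  shows "digit_sum p (a + p ^ r * q) = digit_sum p a + digit_sum p q"
  using assms(2)
proof (induction r arbitrary: a)
  case (Suc r)
  have c: "a mod p < p" using assms by simp
  have a: "a = p * (a div p) + a mod p" by simp
  have "a div p < p ^ r"
    using Suc.prems assms by (simp add: less_mult_imp_div_less mult.commute)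
  then have IH: "digit_sum p (a div p + p ^ r * q) = digit_sum p (a div p) + digit_sum p q"
    by (rule Suc.IH)
  have "a + p ^ Suc r * q = p * (a div p + p ^ r * q) + a mod p"
    by (subst a) (simp only: power_Suc algebra_simps)
  then have "digit_sum p (a + p ^ Suc r * q)
      = a mod p + (digit_sum p (a div p) + digit_sum p q)"
    using digit_sum_mult_add[OF assms(1) c] IH by simp
  also have "\<dots> = digit_sum p a + digit_sum p q"
    using digit_sum_mult_add[OF assms(1) c, of "a div p"] by simp
  finally show ?case .
qed simp

lemma digit_sum_pos:
  assumes "p \<ge> 2" "m > 0"
  shows "digit_sum p m > 0"
  using assms(2)
proof (induction m rule: less_induct)
  case (less m)
  have c: "m mod p < p" using assms by simp
  have eq: "digit_sum p m = m mod p + digit_sum p (m div p)"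
    using digit_sum_mult_add[OF assms(1) c, of "m div p"] by simp
  show ?case
  proof (cases "m mod p = 0")
    case True
    then have "p dvd m" by auto
    then have "m div p > 0" using less.prems by (auto simp: dvd_div_eq_0_iff intro: gr0I)
    moreover have "m div p < m" using less.prems assms by simp
    ultimately show ?thesis using eq less.IH[of "m div p"] by simp
  qed (simp add: eq)
qed

text \<open>Adding 1 turns each trailing digit \<open>p - 1\<close> into 0, and the number of these
  digits is the multiplicity of \<open>p\<close> in \<open>Suc n\<close>. The induction removes one
  of them at a time.\<close>

lemma digit_sum_Suc:
  assumes "prime p"
  shows "int (digit_sum p (Suc n))
    = int (digit_sum p n) + 1 - (int p - 1) * int (multiplicity p (Suc n))"
proof (induction n rule: less_induct)
  case (less n)
  have p: "p \<ge> 2" using assms by (rule prime_ge_2_nat)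
  show ?case
  proof (cases "p dvd Suc n")
    case False
    define m c where "m = n div p" and "c = n mod p"
    have n: "n = p * m + c" by (simp add: m_def c_def)
    have "c < p" using p by (simp add: c_def)
    moreover have "Suc c \<noteq> p"
    proof
      assume "Suc c = p"
      then have "Suc n = p * Suc m" using n by simp
      then show False using False by simp
    qed
    ultimately have "Suc c < p" by simp
    from digit_sum_mult_add[OF p this, of m] digit_sum_mult_add[OF p \<open>c < p\<close>, of m]
    have "digit_sum p (Suc n) = Suc (digit_sum p n)" by (simp add: n)
    then show ?thesis using False by (simp add: not_dvd_imp_multiplicity_0)
  next
    case True
    then obtain m' where m': "Suc n = p * m'" by blast
    then have "m' \<noteq> 0" by (intro notI) simp
    then obtain m where m: "m' = Suc m" using not0_implies_Suc by blast
    have "m < n"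
    proof -
      have "2 * Suc m \<le> Suc n" unfolding m' m using p by (intro mult_right_mono) auto
      then show ?thesis by simp
    qed
    \<comment> \<open>As \<open>p\<close> divides \<open>Suc n\<close>, the last digit of
      \<open>n\<close> is \<open>p - 1\<close>.\<close>
    have "n = p * m + (p - 1)" using m' m p by (simp add: algebra_simps)
    then have 1: "digit_sum p n = p - 1 + digit_sum p m"
      using digit_sum_mult_add[of p "p - 1" m] p by simp
    have 2: "digit_sum p (Suc n) = digit_sum p (Suc m)"
      using digit_sum_mult_add[of p 0 "Suc m"] p m' m by simp
    have 3: "multiplicity p (Suc n) = Suc (multiplicity p (Suc m))"
      unfolding m' m using assms p by (intro multiplicity_times_same) auto
    show ?thesis
      using less.IH[OF \<open>m < n\<close>] p unfolding 1 2 3 by (simp add: algebra_simps of_nat_diff)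
  qed
qed

text \<open>\<open>digit_sum_Suc\<close> telescopes along the factors of the factorial.\<close>

lemma legendre_digit_sum:
  assumes "prime p"
  shows "(int p - 1) * int (multiplicity p (fact n :: nat)) = int n - int (digit_sum p n)"
proof (induction n)
  case (Suc n)
  have "multiplicity p (fact (Suc n) :: nat)
      = multiplicity p (Suc n) + multiplicity p (fact n :: nat)"
    unfolding fact_Suc of_nat_id
    using assms by (intro prime_elem_multiplicity_mult_distrib) auto
  then have "(int p - 1) * int (multiplicity p (fact (Suc n) :: nat))
      = (int p - 1) * int (multiplicity p (Suc n)) + (int p - 1) * int (multiplicity p (fact n :: nat))"
    by (simp only: of_nat_add distrib_left)
  then show ?case
    unfolding Suc.IH digit_sum_Suc[OF assms] by simp
qed simp

section \<open>The valuation on the rationals\<close>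

text \<open>Cross-multiplication with the reduced fraction frees the valuation from lowest
  terms.\<close>

lemma padic_val_divide_of_int:
  assumes "prime p" "a \<noteq> 0" "b \<noteq> 0"
  shows "padic_val p (of_int a / of_int b)
    = int (multiplicity (int p) a) - int (multiplicity (int p) b)"
proof -
  obtain u v where uv: "quotient_of (of_int a / of_int b :: rat) = (u, v)" by force
  have v: "v > 0" using quotient_of_denom_pos[OF uv] .
  have eq: "of_int a / of_int b = (of_int u / of_int v :: rat)" using quotient_of_div[OF uv] .
  then have "u \<noteq> 0" using assms v by auto
  from eq have "(of_int (a * v) :: rat) = of_int (u * b)"
    using assms v by (simp add: field_simps)
  then have "a * v = u * b" by (simp only: of_int_eq_iff)
  then have "multiplicity (int p) (a * v) = multiplicity (int p) (u * b)" by simp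
  then have "multiplicity (int p) a + multiplicity (int p) v
      = multiplicity (int p) u + multiplicity (int p) b"
    using assms v \<open>u \<noteq> 0\<close> by (simp add: prime_elem_multiplicity_mult_distrib)
  then show ?thesis unfolding padic_val_def uv by simp
qed

lemma rat_fractionE:
  fixes x :: rat
  obtains a b where "x = of_int a / of_int b" "b \<noteq> 0"
proof -
  obtain u v where uv: "quotient_of x = (u, v)" by force
  show thesis using that[OF quotient_of_div[OF uv]] quotient_of_denom_pos[OF uv] by simp
qed

lemma padic_val_mult:
  assumes "prime p" "x \<noteq> 0" "y \<noteq> 0"
  shows "padic_val p (x * y) = padic_val p x + padic_val p y"
proof -
  obtain a b where x: "x = of_int a / of_int b" "b \<noteq> 0" by (rule rat_fractionE)
  obtain c d where y: "y = of_int c / of_int d" "d \<noteq> 0" by (rule rat_fractionE)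
  have nz: "a \<noteq> 0" "c \<noteq> 0" using assms x y by auto
  have "x * y = of_int (a * c) / of_int (b * d)" by (simp add: x y)
  then have "padic_val p (x * y) = int (multiplicity (int p) (a * c)) - int (multiplicity (int p) (b * d))"
    using assms(1) x(2) y(2) nz by (simp only: padic_val_divide_of_int mult_eq_0_iff simp_thms)
  also have "\<dots> = padic_val p x + padic_val p y"
    using assms(1) x y nz by (simp add: padic_val_divide_of_int prime_elem_multiplicity_mult_distrib)
  finally show ?thesis .
qed

lemma padic_val_1 [simp]: "padic_val p 1 = 0"
  using padic_val_of_int[of p 1] by simp

lemma padic_val_inverse:
  assumes "prime p" "x \<noteq> 0"
  shows "padic_val p (inverse x) = - padic_val p x"
  using padic_val_mult[of p x "inverse x"] assms by simp

lemma padic_val_divide: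
  assumes "prime p" "x \<noteq> 0" "y \<noteq> 0"
  shows "padic_val p (x / y) = padic_val p x - padic_val p y"
  using assms by (simp add: divide_inverse padic_val_mult padic_val_inverse)

text \<open>Over a common denominator, a power of \<open>p\<close> dividing both numerators divides
  their sum.\<close>

lemma padic_val_add:
  assumes "prime p" "x \<noteq> 0" "y \<noteq> 0" "x + y \<noteq> 0"
  shows "min (padic_val p x) (padic_val p y) \<le> padic_val p (x + y)"
proof -
  obtain a b where x: "x = of_int a / of_int b" "b \<noteq> 0" by (rule rat_fractionE)
  obtain c d where y: "y = of_int c / of_int d" "d \<noteq> 0" by (rule rat_fractionE)
  define A C where "A = a * d" and "C = c * b"
  have x': "x = of_int A / of_int (b * d)" and y': "y = of_int C / of_int (b * d)"
    using x y by (auto simp: A_def C_def)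
  have xy: "x + y = of_int (A + C) / of_int (b * d)"
    unfolding x' y' by (simp add: add_divide_distrib)
  have nz: "A \<noteq> 0" "C \<noteq> 0" "A + C \<noteq> 0" "b * d \<noteq> 0"
    using assms x' y' xy x(2) y(2) by auto
  define e where "e = min (multiplicity (int p) A) (multiplicity (int p) C)"
  have "int p ^ e dvd A + C"
    by (intro dvd_add multiplicity_dvd') (auto simp: e_def)
  moreover have "\<not> is_unit (int p)" using assms by auto
  ultimately have "e \<le> multiplicity (int p) (A + C)"
    using nz by (intro multiplicity_geI) auto
  moreover have "padic_val p x = int (multiplicity (int p) A) - int (multiplicity (int p) (b * d))"
    unfolding x' using assms(1) nz by (intro padic_val_divide_of_int)
  moreover have "padic_val p y = int (multiplicity (int p) C) - int (multiplicity (int p) (b * d))"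
    unfolding y' using assms(1) nz by (intro padic_val_divide_of_int)
  moreover have "padic_val p (x + y) = int (multiplicity (int p) (A + C)) - int (multiplicity (int p) (b * d))"
    unfolding xy using assms(1) nz by (intro padic_val_divide_of_int)
  ultimately show ?thesis by (simp add: e_def)
qed

text \<open>The factor \<open>p - 1\<close> clears the denominators of the bounds \<open>- j / (p - 1)\<close>.\<close>

definition scaled_val_ge :: "nat \<Rightarrow> int \<Rightarrow> rat \<Rightarrow> bool" where
  "scaled_val_ge p e x \<longleftrightarrow> x = 0 \<or> e \<le> (int p - 1) * padic_val p x"

text \<open>Here zero behaves as if its valuation were infinite, so the rules for sums and products
  need no nonvanishing hypotheses.\<close>

lemma scaled_val_ge_0 [simp]: "scaled_val_ge p e 0"
  by (simp add: scaled_val_ge_def)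

lemma scaled_val_ge_mono: "scaled_val_ge p e x \<Longrightarrow> e' \<le> e \<Longrightarrow> scaled_val_ge p e' x"
  by (auto simp: scaled_val_ge_def)

lemma scaled_val_ge_mult:
  assumes "prime p" "scaled_val_ge p e x" "scaled_val_ge p e' y"
  shows "scaled_val_ge p (e + e') (x * y)"
proof (cases "x = 0 \<or> y = 0")
  case False
  then have "padic_val p (x * y) = padic_val p x + padic_val p y"
    using assms(1) by (simp add: padic_val_mult)
  then show ?thesis using assms(2,3) False by (simp add: scaled_val_ge_def distrib_left)
qed auto

lemma scaled_val_ge_add:
  assumes "prime p" "scaled_val_ge p e x" "scaled_val_ge p e y"
  shows "scaled_val_ge p e (x + y)"
proof (cases "x = 0 \<or> y = 0 \<or> x + y = 0")
  case False
  have "p \<ge> 1" using assms prime_ge_1_nat by blast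
  have "e \<le> (int p - 1) * min (padic_val p x) (padic_val p y)"
    using assms False by (auto simp: scaled_val_ge_def min_def)
  also have "\<dots> \<le> (int p - 1) * padic_val p (x + y)"
    using padic_val_add[of p x y] assms False \<open>p \<ge> 1\<close> by (intro mult_left_mono) auto
  finally show ?thesis by (simp add: scaled_val_ge_def)
qed (use assms in \<open>auto simp: scaled_val_ge_def\<close>)

lemma scaled_val_ge_sum:
  assumes "prime p" "\<And>i. i \<in> A \<Longrightarrow> scaled_val_ge p e (f i)"
  shows "scaled_val_ge p e (sum f A)"
  using assms(2) by (induction A rule: infinite_finite_induct) (auto intro: scaled_val_ge_add assms(1))

lemma scaled_val_ge_of_int:
  assumes "prime p"
  shows "scaled_val_ge p 0 (of_int a)"
  using prime_ge_1_nat[OF assms] by (simp add: scaled_val_ge_def padic_val_of_int)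

lemma scaled_val_ge_minus:
  assumes "prime p" "scaled_val_ge p e x"
  shows "scaled_val_ge p e (- x)"
  using scaled_val_ge_mult[OF assms(1) scaled_val_ge_of_int[OF assms(1), of "-1"] assms(2)] by simp

lemma scaled_val_ge_divide:
  assumes "prime p" "scaled_val_ge p e x" "y \<noteq> 0"
  shows "scaled_val_ge p (e - (int p - 1) * padic_val p y) (x / y)"
proof (cases "x = 0")
  case False
  then have "padic_val p (x / y) = padic_val p x - padic_val p y"
    using assms(1,3) by (simp add: padic_val_divide)
  then show ?thesis using assms(2) False by (simp add: scaled_val_ge_def right_diff_distrib)
qed simp

text \<open>A multiple of \<open>p - 1\<close> that is at least 1 is at least \<open>p - 1\<close>.
  Hence a gain of just 1 in the scaled bounds already yields a congruence.\<close>

lemma rat_cong_iff_scaled_val_ge: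
  assumes "prime p"
  shows "rat_cong p x y \<longleftrightarrow> scaled_val_ge p 1 (x - y)"
proof -
  have "int p - 1 > 0" using prime_gt_1_nat[OF assms] by simp
  then have "1 \<le> (int p - 1) * v \<longleftrightarrow> 1 \<le> v" for v
    using zero_less_mult_iff[of "int p - 1" v] by linarith
  then show ?thesis by (simp add: rat_cong_def scaled_val_ge_def)
qed

text \<open>Writing 1 as \<open>x - (x - 1)\<close> excludes positive valuation of \<open>x\<close>;
  writing \<open>x\<close> as \<open>(x - 1) + 1\<close> excludes negative valuation.\<close>

lemma rat_cong_1_val:
  assumes "prime p" "rat_cong p x 1"
  shows "x \<noteq> 0" "padic_val p x = 0"
proof -
  have p: "int p - 1 > 0" using prime_gt_1_nat[OF assms(1)] by simp
  have d: "scaled_val_ge p 1 (x - 1)" using assms by (simp add: rat_cong_iff_scaled_val_ge)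
  have not1: "\<not> scaled_val_ge p 1 1" by (simp add: scaled_val_ge_def)
  have x: "\<not> scaled_val_ge p 1 x"
  proof
    assume "scaled_val_ge p 1 x"
    from scaled_val_ge_add[OF assms(1) this scaled_val_ge_minus[OF assms(1) d]] not1
    show False by simp
  qed
  then show "x \<noteq> 0" by auto
  have "scaled_val_ge p 0 (x - 1 + 1)"
    using d scaled_val_ge_of_int[OF assms(1), of 1]
    by (intro scaled_val_ge_add assms) (auto intro: scaled_val_ge_mono)
  then have "(int p - 1) * padic_val p x = 0"
    using x by (simp add: scaled_val_ge_def del: mult_eq_0_iff)
  then show "padic_val p x = 0" using p by simp
qed

lemma rat_cong_1_mult:
  assumes "prime p" "rat_cong p x 1" "rat_cong p y 1"
  shows "rat_cong p (x * y) 1"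
proof -
  have dx: "scaled_val_ge p 1 (x - 1)" and dy: "scaled_val_ge p 1 (y - 1)"
    using assms by (simp_all add: rat_cong_iff_scaled_val_ge)
  have "scaled_val_ge p 1 ((x - 1) * (y - 1))"
    using scaled_val_ge_mult[OF assms(1) dx dy] by (rule scaled_val_ge_mono) simp
  \<comment> \<open>This sum equals \<open>x * y - 1\<close>.\<close>
  then have "scaled_val_ge p 1 ((x - 1) * (y - 1) + ((x - 1) + (y - 1)))"
    by (intro scaled_val_ge_add assms dx dy)
  then show ?thesis
    using assms by (simp add: rat_cong_iff_scaled_val_ge algebra_simps)
qed

text \<open>The difference \<open>x / y - 1\<close> is \<open>(x - y) / y\<close>, and dividing by
  \<open>y\<close> costs nothing since \<open>y\<close> has valuation 0.\<close>

lemma rat_cong_1_divide: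
  assumes "prime p" "rat_cong p x 1" "rat_cong p y 1"
  shows "rat_cong p (x / y) 1"
proof -
  have dx: "scaled_val_ge p 1 (x - 1)" and dy: "scaled_val_ge p 1 (y - 1)"
    using assms by (simp_all add: rat_cong_iff_scaled_val_ge)
  note y = rat_cong_1_val[OF assms(1,3)]
  have "scaled_val_ge p 1 (x - y)"
    using scaled_val_ge_add[OF assms(1) dx scaled_val_ge_minus[OF assms(1) dy]] by simp
  from scaled_val_ge_divide[OF assms(1) this y(1)] show ?thesis
    using assms y by (simp add: rat_cong_iff_scaled_val_ge diff_divide_distrib)
qed

text \<open>Since \<open>u\<close> has valuation 0, the two unit parts carry the same power of
  \<open>p\<close> and differ by \<open>padic_unit p x * (u - 1)\<close>. This reduces (i) and (ii)
  to a statement about the quotient of the Stirling numbers.\<close>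

lemma padic_unit_mult_rat_cong_1:
  assumes "prime p" "x \<noteq> 0" "rat_cong p u 1"
  shows "padic_val p (x * u) = padic_val p x"
    and "rat_cong p (padic_unit p (x * u)) (padic_unit p x)"
proof -
  note u = rat_cong_1_val[OF assms(1,3)]
  show val: "padic_val p (x * u) = padic_val p x"
    using assms u by (simp add: padic_val_mult)
  have p: "padic_val p (of_nat p) = 1"
    using assms(1) unfolding padic_val_of_nat by (simp add: not_prime_unit)
  have p0: "(of_nat p :: rat) \<noteq> 0" using assms(1) by (simp add: prime_gt_0_nat)
  have pow: "padic_val p (of_nat p ^ j) = int j" for j
    using assms(1) p p0 by (induction j) (simp_all add: padic_val_mult)
  have powi: "padic_val p (of_nat p powi j) = j" for j
    using assms(1) p0 pow by (auto simp: power_int_def padic_val_inverse power_inverse)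
  have "padic_val p (padic_unit p x) = 0"
    using assms p0 by (simp add: padic_unit_def padic_val_mult powi)
  then have "scaled_val_ge p 0 (padic_unit p x)" by (simp add: scaled_val_ge_def)
  from scaled_val_ge_mult[OF assms(1) this] assms(1,3)
  have "scaled_val_ge p 1 (padic_unit p x * (u - 1))"
    by (simp add: rat_cong_iff_scaled_val_ge)
  moreover have "padic_unit p (x * u) - padic_unit p x = padic_unit p x * (u - 1)"
    unfolding padic_unit_def val by (simp add: algebra_simps)
  ultimately show "rat_cong p (padic_unit p (x * u)) (padic_unit p x)"
    using assms(1) by (simp add: rat_cong_iff_scaled_val_ge)
qed

section \<open>Binomial coefficients congruent to 1 modulo \<open>p\<close>\<close>

lemma padic_val_of_nat_ge_power:
  assumes "prime p" "m > 0" "p ^ r dvd m"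
  shows "int r \<le> padic_val p (of_nat m)"
  using assms multiplicity_geI[of m p r] prime_gt_1_nat[OF assms(1)] unfolding padic_val_of_nat by simp

lemma padic_val_of_nat_less_power:
  assumes "prime p" "m > 0" "\<not> p ^ r dvd m"
  shows "padic_val p (of_nat m) < int r"
  using assms multiplicity_lessI[of m p r] prime_gt_1_nat[OF assms(1)] unfolding padic_val_of_nat by simp

text \<open>The binomial coefficient is the product of \<open>1 + n / i\<close> over
  \<open>i\<close> from 1 to \<open>b\<close>, and each such \<open>i\<close> has smaller valuation
  than a nonzero \<open>n\<close>.\<close>

lemma binomial_rat_cong_1:
  assumes "prime p" "p ^ r dvd n" "b < p ^ r"
  shows "rat_cong p (of_nat ((n + b) choose b)) 1"
  using assms(3)
proof (induction b)
  case 0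
  show ?case by (simp add: rat_cong_def)
next
  case (Suc b)
  have "rat_cong p (of_nat (n + Suc b) / of_nat (Suc b)) 1"
  \<comment> \<open>The default value 0 of \<open>padic_val\<close> at 0 makes the comparison of
    valuations unusable for \<open>n = 0\<close>, where the quotient is simply 1.\<close>
  proof (cases "n = 0")
    case True
    then show ?thesis by (simp add: rat_cong_def flip: of_nat_Suc)
  next
    case False
    have "\<not> p ^ r dvd Suc b" using Suc.prems by (auto dest: dvd_imp_le)
    then have "padic_val p (of_nat (Suc b)) < padic_val p (of_nat n)"
      using padic_val_of_nat_less_power[OF assms(1), of "Suc b" r]
        padic_val_of_nat_ge_power[OF assms(1) _ assms(2)] False by fastforce
    moreover have "of_nat (n + Suc b) / of_nat (Suc b) - 1 = (of_nat n / of_nat (Suc b) :: rat)"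
      by (simp add: field_simps flip: of_nat_Suc)
    ultimately show ?thesis
      using assms(1) False unfolding rat_cong_def
      by (auto simp: padic_val_divide simp del: of_nat_Suc of_nat_add)
  qed
  moreover have "rat_cong p (of_nat ((n + b) choose b)) 1" using Suc by simp
  ultimately have "rat_cong p (of_nat (n + Suc b) / of_nat (Suc b) * of_nat ((n + b) choose b)) 1"
    by (rule rat_cong_1_mult[OF assms(1)])
  moreover have "of_nat (n + Suc b) / of_nat (Suc b) * of_nat ((n + b) choose b)
      = (of_nat ((n + Suc b) choose Suc b) :: rat)"
  proof -
    have "(of_nat (Suc b) :: rat) * of_nat (Suc (n + b) choose Suc b)
        = of_nat (Suc (n + b)) * of_nat ((n + b) choose b)"
      by (simp only: Suc_times_binomial flip: of_nat_mult)
    then show ?thesis by (simp add: field_simps flip: of_nat_Suc)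
  qed
  ultimately show ?case by simp
qed

section \<open>Coefficients of the powers of \<open>(exp t - 1) / t\<close>\<close>

definition expm1_quot :: "rat fps" where
  "expm1_quot = Abs_fps (\<lambda>j. 1 / fact (Suc j))"

text \<open>Differentiating \<open>(exp t - 1) ^ k\<close> and comparing coefficients reproduces the
  recurrence \<open>S(n + 1, k) = S(n, k - 1) + k S(n, k)\<close>.\<close>

lemma expm1_power_nth:
  "(fps_exp (1 :: rat) - 1) ^ k $ n = fact k * of_nat (Stirling n k) / fact n"
proof (induction n arbitrary: k)
  case 0
  then show ?case by (cases k) simp_all
next
  case (Suc n)
  show ?case
  proof (cases k)
    case (Suc k')
    let ?e = "fps_exp (1 :: rat)"
    have "fps_deriv ((?e - 1) ^ k) = of_nat k * ((?e - 1) ^ k' + (?e - 1) ^ k)"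
    proof -
      have "?e * (?e - 1) ^ k' = (?e - 1) ^ k' + (?e - 1) ^ k"
        by (simp add: Suc algebra_simps)
      moreover have "fps_deriv ((?e - 1) ^ k) = of_nat k * fps_deriv (?e - 1) * (?e - 1) ^ (k - 1)"
        by (rule fps_deriv_power')
      moreover have "fps_deriv (?e - 1) = ?e" "k - 1 = k'"
        by (simp_all add: Suc)
      ultimately show ?thesis by (simp only: mult.assoc)
    qed
    then have "fps_deriv ((?e - 1) ^ k) $ n
        = of_nat k * ((?e - 1) ^ k' $ n + (?e - 1) ^ k $ n)"
      by (simp add: fps_mult_of_nat_nth)
    then have "of_nat (Suc n) * ((?e - 1) ^ k $ Suc n)
        = of_nat k * ((?e - 1) ^ k' $ n + (?e - 1) ^ k $ n)"
      by simp
    also have "\<dots> = fact k * of_nat (Stirling (Suc n) k) / fact n"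
      unfolding Suc.IH by (simp add: Suc field_simps)
    finally show ?thesis
      by (simp add: field_simps del: of_nat_Suc)
  qed simp
qed

lemma expm1_quot_power_nth:
  "expm1_quot ^ k $ m = of_nat (Stirling (m + k) k) * fact k / fact (m + k)"
proof -
  have "fps_exp (1 :: rat) - 1 = fps_X * expm1_quot"
    by (rule fps_ext) (auto simp: expm1_quot_def simp del: fact_Suc)
  then have "(fps_exp (1 :: rat) - 1) ^ k $ (m + k) = (fps_X ^ k * expm1_quot ^ k) $ (m + k)"
    by (simp add: power_mult_distrib)
  also have "\<dots> = expm1_quot ^ k $ m" by (simp add: fps_X_power_mult_nth)
  finally show ?thesis by (simp add: expm1_power_nth mult.commute)
qed

section \<open>Lower bounds for the valuations of the coefficients\<close>

lemma padic_val_fact: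
  assumes "prime p"
  shows "(int p - 1) * padic_val p (fact n) = int n - int (digit_sum p n)"
  using legendre_digit_sum[OF assms, of n] padic_val_of_nat[of p "fact n"] by simp

text \<open>Legendre's formula is applied to both factorials. The right side is
  \<open>- int m\<close> exactly when \<open>S(m + k, k)\<close> attains the value required of a
  minimum zero case.\<close>

lemma scaled_val_expm1_quot_power:
  assumes "prime p" "Stirling (m + k) k \<noteq> 0"
  shows "(int p - 1) * padic_val p (expm1_quot ^ k $ m)
    = (int p - 1) * padic_val p (of_nat (Stirling (m + k) k))
      + int (digit_sum p (m + k)) - int (digit_sum p k) - int m"
proof -
  have "padic_val p (expm1_quot ^ k $ m) = padic_val p (of_nat (Stirling (m + k) k))
      + padic_val p (fact k) - padic_val p (fact (m + k))"
    using assms by (simp add: expm1_quot_power_nth padic_val_divide padic_val_mult)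
  then have "(int p - 1) * padic_val p (expm1_quot ^ k $ m)
      = (int p - 1) * padic_val p (of_nat (Stirling (m + k) k))
        + (int p - 1) * padic_val p (fact k) - (int p - 1) * padic_val p (fact (m + k))"
    by (simp only: right_diff_distrib distrib_left)
  then show ?thesis
    unfolding padic_val_fact[OF assms(1)] by simp
qed

text \<open>By Legendre the scaled valuation of the coefficient is
  \<open>digit_sum p (Suc j) - Suc j\<close>, and a positive number has digit sum at least
  1.\<close>

lemma expm1_quot_scaled_val_ge:
  assumes "prime p"
  shows "scaled_val_ge p (- int j) (expm1_quot $ j)"
proof -
  have "digit_sum p (Suc j) \<ge> 1"
    using digit_sum_pos[of p "Suc j"] prime_ge_2_nat[OF assms] by simp
  then have "- int j \<le> - ((int p - 1) * padic_val p (fact (Suc j)))"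
    unfolding padic_val_fact[OF assms] by simp
  then show ?thesis
    using assms by (simp add: expm1_quot_def scaled_val_ge_def padic_val_divide del: fact_Suc)
qed

text \<open>The bound is additive in the index, hence stable under convolution.\<close>

lemma expm1_quot_power_scaled_val_ge:
  assumes "prime p"
  shows "scaled_val_ge p (- int m) (expm1_quot ^ k $ m)"
proof (induction k arbitrary: m)
  case 0
  show ?case by (simp add: scaled_val_ge_def)
next
  case (Suc k)
  have "scaled_val_ge p (- int m) (expm1_quot $ i * expm1_quot ^ k $ (m - i))" if "i \<le> m" for i
    using scaled_val_ge_mult[OF assms expm1_quot_scaled_val_ge[OF assms, of i] Suc, of "m - i"] that
    by (simp add: of_nat_diff)
  then show ?case
    by (auto simp: fps_mult_nth intro!: scaled_val_ge_sum assms)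
qed

text \<open>Comparing coefficients in \<open>(f ^ k)' = k f' f ^ (k - 1)\<close> gains \<open>\<nu>\<^sub>p(k) - \<nu>\<^sub>p(i)\<close> over the
  general bound.\<close>

lemma expm1_quot_power_scaled_val_gt_of_not_dvd:
  assumes "prime p" "p ^ r dvd k" "k > 0" "\<not> p ^ r dvd i"
  shows "scaled_val_ge p (- int i + 1) (expm1_quot ^ k $ i)"
proof -
  have "i > 0" using assms(4) by (intro gr0I) auto
  then obtain i' where i': "i = Suc i'" using gr0_implies_Suc by blast
  define s where "s = (fps_deriv expm1_quot * expm1_quot ^ (k - 1)) $ i'"
  \<comment> \<open>The indices \<open>Suc j\<close> and \<open>i' - j\<close> add up to
    \<open>i\<close>, and the integer factor from differentiation cannot lower the
    valuation.\<close>
  have "scaled_val_ge p (- int i) (of_nat (Suc j) * expm1_quot $ Suc j * expm1_quot ^ (k - 1) $ (i' - j))"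
    if "j \<le> i'" for j
  proof -
    have "scaled_val_ge p (0 + - int (Suc j) + - int (i' - j))
        (of_int (int (Suc j)) * expm1_quot $ Suc j * expm1_quot ^ (k - 1) $ (i' - j))"
      by (intro scaled_val_ge_mult scaled_val_ge_of_int expm1_quot_scaled_val_ge
          expm1_quot_power_scaled_val_ge assms)
    then show ?thesis using that by (simp add: i' of_nat_diff)
  qed
  then have s: "scaled_val_ge p (- int i) s"
    unfolding s_def fps_mult_nth by (intro scaled_val_ge_sum assms) auto
  have "fps_deriv (expm1_quot ^ k) $ i' = of_nat k * s"
    by (simp add: fps_deriv_power' s_def mult.assoc fps_mult_of_nat_nth)
  then have "of_nat i * (expm1_quot ^ k $ i) = of_nat k * s"
    by (simp add: i')
  then have eq: "expm1_quot ^ k $ i = of_nat k / of_nat i * s"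
    using \<open>i > 0\<close> by (simp add: field_simps)
  have "int p - 1 > 0" using prime_gt_1_nat[OF assms(1)] by simp
  \<comment> \<open>The valuation of \<open>k\<close> is at least \<open>r\<close>, that of
    \<open>i\<close> below \<open>r\<close>.\<close>
  moreover have "padic_val p (of_nat k / of_nat i) \<ge> 1"
    using padic_val_of_nat_ge_power[OF assms(1,3,2)] padic_val_of_nat_less_power[OF assms(1) \<open>i > 0\<close> assms(4)]
      \<open>i > 0\<close> assms(1,3) by (simp add: padic_val_divide)
  ultimately have "1 \<le> (int p - 1) * padic_val p (of_nat k / of_nat i)"
    by (smt (verit) mult_le_cancel_left1)
  then have "scaled_val_ge p 1 (of_nat k / of_nat i)" by (simp add: scaled_val_ge_def)
  from scaled_val_ge_mult[OF assms(1) this s] show ?thesis by (simp add: eq add.commute)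
qed

text \<open>Equality in the general bound would force \<open>\<nu>\<^sub>p(S(j + b, b))\<close> to be negative,
  since \<open>\<sigma>\<^sub>p(j + b) > \<sigma>\<^sub>p(b)\<close>.\<close>

lemma expm1_quot_power_scaled_val_gt_of_dvd:
  assumes "prime p" "b < p ^ r" "p ^ r dvd j" "j > 0"
  shows "scaled_val_ge p (- int j + 1) (expm1_quot ^ b $ j)"
proof (cases "Stirling (j + b) b = 0")
  case True
  then show ?thesis by (simp add: expm1_quot_power_nth)
next
  case False
  have p: "p \<ge> 2" using assms(1) by (rule prime_ge_2_nat)
  from assms obtain q where q: "j = p ^ r * q" by blast
  have "digit_sum p (j + b) = digit_sum p b + digit_sum p q"
    using digit_sum_add_power_mult[OF p assms(2), of q] by (simp add: q add.commute)
  moreover have "digit_sum p q > 0"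
    using p assms(4) q by (intro digit_sum_pos) (auto intro: gr0I)
  moreover have "(int p - 1) * padic_val p (of_nat (Stirling (j + b) b)) \<ge> 0"
    unfolding padic_val_of_nat using p by simp
  ultimately show ?thesis
    unfolding scaled_val_ge_def scaled_val_expm1_quot_power[OF assms(1) False] by simp
qed

text \<open>In each product with \<open>i < m\<close> one factor beats its bound: that of
  \<open>f ^ k\<close> if \<open>p ^ r\<close> does not divide \<open>i\<close>, and otherwise that
  of \<open>f ^ b\<close>, as \<open>p ^ r\<close> then divides the positive number
  \<open>m - i\<close>.\<close>

lemma expm1_quot_power_shift:
  assumes "prime p" "p ^ r dvd k" "k > 0" "p ^ r dvd m" "b < p ^ r"
  shows "scaled_val_ge p (- int m + 1) (expm1_quot ^ (k + b) $ m - expm1_quot ^ k $ m)"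
proof -
  let ?t = "\<lambda>i. expm1_quot ^ k $ i * expm1_quot ^ b $ (m - i)"
  have "scaled_val_ge p (- int m + 1) (?t i)" if "i < m" for i
  proof (cases "p ^ r dvd i")
    case True
    then have "p ^ r dvd m - i" using assms by (simp add: dvd_diff_nat)
    from scaled_val_ge_mult[OF assms(1) expm1_quot_power_scaled_val_ge[OF assms(1)]
        expm1_quot_power_scaled_val_gt_of_dvd[OF assms(1,5) this], of i k] that
    show ?thesis by (simp add: of_nat_diff)
  next
    case False
    from scaled_val_ge_mult[OF assms(1) expm1_quot_power_scaled_val_gt_of_not_dvd[OF assms(1-3) this]
        expm1_quot_power_scaled_val_ge[OF assms(1)], of "m - i" b] that
    show ?thesis by (simp add: of_nat_diff add.commute)
  qed
  then have "scaled_val_ge p (- int m + 1) (\<Sum>i<m. ?t i)"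
    by (intro scaled_val_ge_sum assms) auto
  \<comment> \<open>In the term \<open>i = m\<close> the factor from \<open>f ^ b\<close> is its
    constant term 1.\<close>
  moreover have "expm1_quot ^ (k + b) $ m = (\<Sum>i<m. ?t i) + expm1_quot ^ k $ m"
    unfolding power_add fps_mult_nth atLeast0AtMost lessThan_Suc_atMost[symmetric]
    by (simp add: expm1_quot_power_nth)
  ultimately show ?thesis by simp
qed

section \<open>Minimum zero cases and the shift by \<open>b\<close>\<close>

lemma minimum_zero_case_iff:
  assumes "prime p"
  shows "minimum_zero_case p n k \<longleftrightarrow> Stirling n k \<noteq> 0 \<and>
    (int p - 1) * padic_val p (of_nat (Stirling n k)) = int (digit_sum p k) - int (digit_sum p n)"
proof -
  have "(of_nat p - 1 :: rat) \<noteq> 0" using prime_gt_1_nat[OF assms] by simp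
  then have "(of_int v = (of_nat a - of_nat c) / (of_nat p - 1 :: rat))
      \<longleftrightarrow> (of_int ((int p - 1) * v) = (of_int (int a - int c) :: rat))" for v a c
    by (simp add: field_simps)
  then show ?thesis by (simp only: minimum_zero_case_def of_int_eq_iff)
qed

theorem theorem2p3:
  fixes p n k b :: nat
  assumes "prime p" and "n > 0" and "k > 0"
    and "minimum_zero_case p n k"
    and "b < min (p ^ multiplicity p k) (p ^ multiplicity p n)"
  shows "minimum_zero_case p (n + b) (k + b) \<and>
         padic_val p (of_nat (Stirling (n + b) (k + b))) = padic_val p (of_nat (Stirling n k)) \<and>
         rat_cong p (padic_unit p (of_nat (Stirling (n + b) (k + b))))
                    (padic_unit p (of_nat (Stirling n k)))"
proof -
  have p: "p \<ge> 2" using assms(1) by (rule prime_ge_2_nat)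
  define r where "r = min (multiplicity p k) (multiplicity p n)"
  have rk: "p ^ r dvd k" and rn: "p ^ r dvd n"
    by (auto simp: r_def intro: multiplicity_dvd')
  have b: "b < p ^ r" using assms(5) by (cases "multiplicity p k \<le> multiplicity p n") (simp_all add: r_def)
  have S: "Stirling n k \<noteq> 0"
    and val: "(int p - 1) * padic_val p (of_nat (Stirling n k)) = int (digit_sum p k) - int (digit_sum p n)"
    using assms(4) by (auto simp: minimum_zero_case_iff[OF assms(1)])
  have "k \<le> n" using S by (meson Stirling_less not_le)
  define m where "m = n - k"
  have n: "n = m + k" using \<open>k \<le> n\<close> by (simp add: m_def)
  have rm: "p ^ r dvd m" unfolding m_def using rn rk by (rule dvd_diff_nat)
  define c c' where "c = expm1_quot ^ k $ m" and "c' = expm1_quot ^ (k + b) $ m"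
  have c: "c = of_nat (Stirling n k) * fact k / fact n"
    and c': "c' = of_nat (Stirling (n + b) (k + b)) * fact (k + b) / fact (n + b)"
    unfolding c_def c'_def expm1_quot_power_nth by (simp_all add: n add.assoc)
  have "c \<noteq> 0" using S by (simp add: c)
  \<comment> \<open>This is where the minimum zero case enters: \<open>c\<close> attains the general
    lower bound, so dividing by it turns the bound \<open>- m + 1\<close> into 1.\<close>
  have vc: "(int p - 1) * padic_val p c = - int m"
    using scaled_val_expm1_quot_power[OF assms(1), of m k] S val by (simp add: c_def n)
  have "scaled_val_ge p (- int m + 1) (c' - c)"
    unfolding c_def c'_def using expm1_quot_power_shift[OF assms(1) rk assms(3) rm b] .
  from scaled_val_ge_divide[OF assms(1) this \<open>c \<noteq> 0\<close>]
  have cc: "rat_cong p (c' / c) 1"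
    using assms(1) \<open>c \<noteq> 0\<close> by (simp add: rat_cong_iff_scaled_val_ge vc diff_divide_distrib)
  \<comment> \<open>The factorials relating \<open>c' / c\<close> to the quotient of Stirling
    numbers combine to a quotient of binomial coefficients, with \<open>fact b\<close>
    cancelling.\<close>
  define u where "u = c' / c * (of_nat ((n + b) choose b) / of_nat ((k + b) choose b))"
  have u: "rat_cong p u 1"
    unfolding u_def using assms(1) rk rn b
    by (intro rat_cong_1_mult rat_cong_1_divide cc binomial_rat_cong_1) auto
  have bin: "(of_nat ((a + b) choose b) :: rat) = fact (a + b) / (fact b * fact a)" for a
    using binomial_fact[of b "a + b"] by simp
  have "of_nat (Stirling n k) * u = of_nat (Stirling (n + b) (k + b))"
    using S unfolding u_def c c' bin by (simp add: field_simps)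
  note S' = padic_unit_mult_rat_cong_1[OF assms(1) _ u, of "of_nat (Stirling n k)", unfolded this]
  have "Stirling (n + b) (k + b) \<noteq> 0"
    using \<open>of_nat (Stirling n k) * u = _\<close> S rat_cong_1_val(1)[OF assms(1) u]
    by (metis mult_eq_0_iff of_nat_eq_0_iff)
  \<comment> \<open>For \<open>a = k\<close> and \<open>a = n\<close> both digit sums grow by that
    of \<open>b\<close>, so their difference is unchanged.\<close>
  moreover have "digit_sum p (a + b) = digit_sum p a + digit_sum p b" if "p ^ r dvd a" for a
  proof -
    from that obtain q where "a = p ^ r * q" by blast
    then show ?thesis
      \<comment> \<open>The instance with 0 in the low places says that \<open>p ^ r * q\<close> and
        \<open>q\<close> have equal digit sums.\<close>
      using digit_sum_add_power_mult[OF p b, of q] digit_sum_add_power_mult[OF p, of 0 r q] p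
      by (simp add: add.commute)
  qed
  ultimately show ?thesis
    using S' S val rk rn by (simp add: minimum_zero_case_iff[OF assms(1)])
qed

end
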